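(* Fix a scenario, i.e. fixed data as described in the context, and let (A) be the reliability-loss minimization problem given in the context, with objective function $R(\boldsymbol P)$. If the objective function $R$ is convex, for example the unserved-energy objective $R(\boldsymbol P)=\sum_{t=1}^T P^{\mathrm{UE}}_t$ (the case of expected unserved energy minimization), then (A) can be equivalently reformulated as the following convex program (B): $$\begin{aligned} \text{minimize}\quad & \sum_{t=1}^T P^{\mathrm{UE}}_t\quad\text{over } P^{\mathrm{CH}}_{i,t},\,P^{\mathrm{DIS}}_{i,t},\,e_{i,t},\,\boldsymbol P^{\mathrm{COL}}_{r,t},\,P^{\mathrm{CUR}}_t,\,P^{\mathrm{UE}}_t\\ \text{subject to, for all } & t\in[T],\ i\in[n_{\mathrm{STO}}],\ r\in[n_{\mathrm{COL}}]:\\ & G_t=P^{\mathrm{U}}_t+P^{\mathrm{V}}_t+\sum_i P^{\mathrm{DIS}}_{i,t}+P^{\mathrm{UE}}_t+g(\boldsymbol P^{\mathrm{COL}}_t),\\ & G_t= D_t+\sum_i P^{\mathrm{CH}}_{i,t}+\tilde F_t+P^{\mathrm{CUR}}_t+l(\boldsymbol P^{\mathrm{COL}}_t),\\ & 0\le P^{\mathrm{CH}}_{i,t}\le \bar P^{\mathrm{CH}}_i,\qquad 0\le P^{\mathrm{DIS}}_{i,t}\le \bar P^{\mathrm{DIS}}_i,\\ & e_{i,1}=s_i,\qquad \underline E_i\le e_{i,t+1}\le \overline E_i,\qquad e_{i,t+1}=e_{i,t}+\eta_iP^{\mathrm{CH}}_{i,t}-P^{\mathrm{DIS}}_{i,t},\\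 & \boldsymbol F_r(\boldsymbol P^{\mathrm{COL}}_{r,t})\le \mathbf 0,\qquad P^{\mathrm{UE}}_t\ge 0,\qquad P^{\mathrm{CUR}}_t\ge 0 . \end{aligned}$$ Here $\tilde F_t$, the aggregate actual power consumption of the flexible-demand resources, is the fixed number $$\tilde F_t=\begin{cases}\sum_j \bar P^{\mathrm{FLEX}}_{j,t}, & S_t\le 0,\\[2pt] \sum_j \bar P^{\mathrm{FLEX}}_{j,t}-\min\big(\sum_j \bar P^{\mathrm{RED}}_{j,t},\,S_t\big), & S_t>0,\end{cases}$$ where $$S_t = D_t+\sum_{j}\bar P^{\mathrm{FLEX}}_{j,t}+\sum_{r}\bar P^{\mathrm{COL}}_{r,t}-P^{\mathrm{U}}_t-P^{\mathrm{V}}_t$$ is the net shortfall between total demand and the available uncontrollable generation at time $t$ before scheduling flexible resources.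
   Context: Notation: $[n]=\{1,\dots,n\}$; $T,n_{\mathrm{STO}},n_{\mathrm{FLEX}},n_{\mathrm{COL}}$ are the numbers of time periods, storage units, flexible-demand resources and colocated resources. Indices: $t\in[T]$, $i\in[n_{\mathrm{STO}}]$, $j\in[n_{\mathrm{FLEX}}]$, $r\in[n_{\mathrm{COL}}]$. All quantities are real. Fixed data (one scenario): total conventional and renewable generation $P^{\mathrm{U}}_t,P^{\mathrm{V}}_t$; inflexible system load $D_t$; baseline consumption $\bar P^{\mathrm{FLEX}}_{j,t}$ and reduction limits $\bar P^{\mathrm{RED}}_{j,t}\ge 0$ of flexible demands; baseline power $\bar P^{\mathrm{COL}}_{r,t}$ of colocated resources; for each storage unit, charge and discharge power limits $\bar P^{\mathrm{CH}}_i,\bar P^{\mathrm{DIS}}_i\ge 0$, energy limits $\underline E_i\le\overline E_i$, initial state of charge $s_i$ and efficiency $\eta_i\in(0,1]$. Each colocated resource $r$ has a decision vector $\boldsymbol P^{\mathrm{COL}}_{r,t}$ in a finite-dimensional real space at each time $t$, and $\boldsymbol P^{\mathrm{COL}}_t=(\boldsymbol P^{\mathrm{COL}}_{r,t})_r$. The functions $g$ and $l$ (aggregate power output and consumption of colocated resources) are real-valued and affine, and each $\boldsymbol F_r$ is a vector-valued function with convex components, representing the operating constraints of resource $r$. Problem (A) (original reliability-loss minimization): minimize the reliability loss $R(\boldsymbol P)$, a real-valued function of the collection $\boldsymbol P$ of all decision variables (for the fixed scenario and system parameters), over the decision variables $P^{\mathrm{CH}}_{i,t}$, $P^{\mathrm{DIS}}_{i,t}$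 (charging and discharging power), $e_{i,t}$ (state of charge, $t=1,\dots,T+1$), $P^{\mathrm{FLEX}}_{j,t}$, $P^{\mathrm{RED}}_{j,t}$ (actual consumption and demand reduction), $\boldsymbol P^{\mathrm{COL}}_{r,t}$, $P^{\mathrm{CUR}}_t$ (curtailed power), $P^{\mathrm{UE}}_t$ (unserved power), subject to, for all $t,i,j,r$: - $G_t=L_t$, where $G_t=P^{\mathrm{U}}_t+P^{\mathrm{V}}_t+\sum_i P^{\mathrm{DIS}}_{i,t}+P^{\mathrm{UE}}_t+g(\boldsymbol P^{\mathrm{COL}}_t)$ is total supply and $L_t=D_t+\sum_i P^{\mathrm{CH}}_{i,t}+\sum_j P^{\mathrm{FLEX}}_{j,t}+P^{\mathrm{CUR}}_t+l(\boldsymbol P^{\mathrm{COL}}_t)$ is total demand; - $P^{\mathrm{CH}}_{i,t}P^{\mathrm{DIS}}_{i,t}=0$; - $0\le P^{\mathrm{CH}}_{i,t}\le\bar P^{\mathrm{CH}}_i$, $0\le P^{\mathrm{DIS}}_{i,t}\le\bar P^{\mathrm{DIS}}_i$; - $e_{i,1}=s_i$, $\underline E_i\le e_{i,t+1}\le\overline E_i$, $e_{i,t+1}=e_{i,t}+\eta_iP^{\mathrm{CH}}_{i,t}-P^{\mathrm{DIS}}_{i,t}$; - $P^{\mathrm{FLEX}}_{j,t}=\bar P^{\mathrm{FLEX}}_{j,t}-P^{\mathrm{RED}}_{j,t}$; - $0\le P^{\mathrm{RED}}_{j,t}\le \bar P^{\mathrm{RED}}_{j,t}\,\mathbf 1\{P^{\mathrm{U}}_t+P^{\mathrm{V}}_t<D_t+\sum_{j'}\bar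 P^{\mathrm{FLEX}}_{j',t}+\sum_{r'}\bar P^{\mathrm{COL}}_{r',t}\}$, where $\mathbf 1\{\cdot\}$ is $1$ if the condition holds and $0$ otherwise; - $\sum_j P^{\mathrm{RED}}_{j,t}\le\max\big(D_t+\sum_{j'}\bar P^{\mathrm{FLEX}}_{j',t}+\sum_{r'}\bar P^{\mathrm{COL}}_{r',t}-(P^{\mathrm{U}}_t+P^{\mathrm{V}}_t),\,0\big)$; - $\boldsymbol F_r(\boldsymbol P^{\mathrm{COL}}_{r,t})\le\mathbf 0$ componentwise; - $P^{\mathrm{UE}}_t\ge 0$, $P^{\mathrm{CUR}}_t\ge 0$. The equivalent reformulation consists in dropping the constraints $P^{\mathrm{CH}}_{i,t}P^{\mathrm{DIS}}_{i,t}=0$ without loss of optimality, and replacing the flexible-demand variables and their constraints by the fixed aggregate consumption $\tilde F_t$.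
   Formalization: For arbitrary convex R the claim is false (e.g. R = −(P^CH+P^DIS)). It is proved for R = ΣP^UE as displayed, and for convex R depending only on e, P^COL and P^UE, in which case (B) is given the objective R instead of ΣP^UE. *)

theory Defs
  imports "HOL-Analysis.Analysis" "HOL-Library.Function_Algebras"
begin

section \<open>Pointwise vector space structure on functions\<close>

instantiation "fun" :: (type, real_vector) real_vector
begin

definition scaleR_fun_def: "c *\<^sub>R f = (\<lambda>x. c *\<^sub>R f x)"

instance
  by standard
    (simp_all add: scaleR_fun_def fun_eq_iff plus_fun_def scaleR_add_right scaleR_add_left)

end

text \<open>
  Numbers of units and dimensions are part of the data, so vectors are functions on \<open>nat\<close> with
  indices \<open>1..n\<close>. Requiring the value \<open>0\<close> outside this range makes \<open>family n X\<close> a copy of the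
  product \<open>X 1 \<times> \<dots> \<times> X n\<close>, and \<open>real_space n\<close> a copy of \<open>\<real>\<^sup>n\<close>.
\<close>

definition family :: "nat \<Rightarrow> (nat \<Rightarrow> 'a::zero set) \<Rightarrow> (nat \<Rightarrow> 'a) set" where
  "family n X = {x. (\<forall>i\<in>{1..n}. x i \<in> X i) \<and> (\<forall>i. i \<notin> {1..n} \<longrightarrow> x i = 0)}"

definition real_space :: "nat \<Rightarrow> (nat \<Rightarrow> real) set" where
  "real_space n = family n (\<lambda>_. UNIV)"

definition affine_on :: "'a::real_vector set \<Rightarrow> ('a \<Rightarrow> real) \<Rightarrow> bool" where
  "affine_on V f \<longleftrightarrow> (\<exists>h c. linear h \<and> (\<forall>x\<in>V. f x = h x + c))"


section \<open>Optimization problems\<close>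

text \<open>
  A minimization problem is given by its feasible set and its objective. The optimal value is
  \<open>\<infinity>\<close> for an infeasible problem and \<open>-\<infinity>\<close> for an unbounded one.
\<close>

definition optimal_value :: "'a set \<Rightarrow> ('a \<Rightarrow> real) \<Rightarrow> ereal" where
  "optimal_value X f = (INF x\<in>X. ereal (f x))"

definition optimal :: "'a set \<Rightarrow> ('a \<Rightarrow> real) \<Rightarrow> 'a \<Rightarrow> bool" where
  "optimal X f = is_arg_min f (\<lambda>x. x \<in> X)"

text \<open>
  Standard form: a convex objective on the decision space \<open>V\<close>, finitely many convex inequality
  constraints and finitely many affine equality constraints.
\<close>

definition convex_program :: "'a::real_vector set \<Rightarrow> 'a set \<Rightarrow> ('a \<Rightarrow> real) \<Rightarrow> bool" where
  "convex_program V X f \<longleftrightarrow> convex_on V f \<and>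
     (\<exists>C E. finite C \<and> finite E \<and> (\<forall>c\<in>C. convex_on V c) \<and> (\<forall>h\<in>E. affine_on V h) \<and>
        X = {x\<in>V. (\<forall>c\<in>C. c x \<le> 0) \<and> (\<forall>h\<in>E. h x = 0)})"

text \<open>
  The problems have the same optimal value, and feasible points as well as optimal solutions of
  either one yield such points of the other with the same objective value; \<open>fwd x y\<close> and \<open>bwd y x\<close>
  state what the transferred point has in common with the given one.
\<close>

definition equivalent_reformulation ::
  "'a set \<Rightarrow> ('a \<Rightarrow> real) \<Rightarrow> 'b set \<Rightarrow> ('b \<Rightarrow> real) \<Rightarrow> ('a \<Rightarrow> 'b \<Rightarrow> bool) \<Rightarrow> ('b \<Rightarrow> 'a \<Rightarrow> bool) \<Rightarrow> bool"
where
  "equivalent_reformulation X f Y h fwd bwd \<longleftrightarrow>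
     optimal_value X f = optimal_value Y h \<and>
     (\<forall>x\<in>X. \<exists>y\<in>Y. fwd x y \<and> h y = f x) \<and>
     (\<forall>y\<in>Y. \<exists>x\<in>X. bwd y x \<and> f x = h y) \<and>
     (\<forall>x. optimal X f x \<longrightarrow> (\<exists>y. optimal Y h y \<and> fwd x y)) \<and>
     (\<forall>y. optimal Y h y \<longrightarrow> (\<exists>x. optimal X f x \<and> bwd y x))"


section \<open>Scenario data\<close>

text \<open>
  Units are indexed before time: \<open>flex_base S j t\<close>. The argument of \<open>col_output\<close> and \<open>col_use\<close>
  (the functions \<open>g\<close> and \<open>l\<close>) is the family \<open>r \<mapsto> P\<^sub>r\<close> of decision vectors at one time; the
  \<open>k\<close>-th component of \<open>F\<^sub>r(p)\<close> is \<open>col_constr S r p k\<close> for \<open>k = 1..n_constr S r\<close>.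
\<close>

record scenario =
  horizon :: nat
  n_sto :: nat
  n_flex :: nat
  n_col :: nat
  conv_gen :: "nat \<Rightarrow> real"
  renew_gen :: "nat \<Rightarrow> real"
  sys_load :: "nat \<Rightarrow> real"
  flex_base :: "nat \<Rightarrow> nat \<Rightarrow> real"
  red_max :: "nat \<Rightarrow> nat \<Rightarrow> real"
  col_base :: "nat \<Rightarrow> nat \<Rightarrow> real"
  ch_max :: "nat \<Rightarrow> real"
  dis_max :: "nat \<Rightarrow> real"
  energy_min :: "nat \<Rightarrow> real"
  energy_max :: "nat \<Rightarrow> real"
  init_soc :: "nat \<Rightarrow> real"
  efficiency :: "nat \<Rightarrow> real"
  col_dim :: "nat \<Rightarrow> nat"
  col_output :: "(nat \<Rightarrow> nat \<Rightarrow> real) \<Rightarrow> real"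
  col_use :: "(nat \<Rightarrow> nat \<Rightarrow> real) \<Rightarrow> real"
  n_constr :: "nat \<Rightarrow> nat"
  col_constr :: "nat \<Rightarrow> (nat \<Rightarrow> real) \<Rightarrow> nat \<Rightarrow> real"

definition valid_scenario :: "scenario \<Rightarrow> bool" where
  "valid_scenario S \<longleftrightarrow>
     (\<forall>j\<in>{1..n_flex S}. \<forall>t\<in>{1..horizon S}. 0 \<le> red_max S j t) \<and>
     (\<forall>i\<in>{1..n_sto S}. 0 \<le> ch_max S i \<and> 0 \<le> dis_max S i \<and> energy_min S i \<le> energy_max S i \<and>
        0 < efficiency S i \<and> efficiency S i \<le> 1) \<and>
     affine_on (family (n_col S) (\<lambda>r. real_space (col_dim S r))) (col_output S) \<and>
     affine_on (family (n_col S) (\<lambda>r. real_space (col_dim S r))) (col_use S) \<and>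
     (\<forall>r\<in>{1..n_col S}. \<forall>k\<in>{1..n_constr S r}.
        convex_on (real_space (col_dim S r)) (\<lambda>p. col_constr S r p k))"

definition shortfall :: "scenario \<Rightarrow> nat \<Rightarrow> real" where
  "shortfall S t = sys_load S t + (\<Sum>j=1..n_flex S. flex_base S j t)
     + (\<Sum>r=1..n_col S. col_base S r t) - conv_gen S t - renew_gen S t"

definition flex_total :: "scenario \<Rightarrow> nat \<Rightarrow> real" where
  "flex_total S t =
     (if shortfall S t \<le> 0 then \<Sum>j=1..n_flex S. flex_base S j t
      else (\<Sum>j=1..n_flex S. flex_base S j t)
             - min (\<Sum>j=1..n_flex S. red_max S j t) (shortfall S t))"


section \<open>The original problem (A) and its reformulation (B)\<close>

type_synonym series = "nat \<Rightarrow> real"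
type_synonym unit_series = "nat \<Rightarrow> nat \<Rightarrow> real"
type_synonym col_series = "nat \<Rightarrow> nat \<Rightarrow> nat \<Rightarrow> real"

text \<open>
  Order of the components: charging, discharging, state of charge, flexible consumption, demand
  reduction, colocated resources, curtailed power, unserved power. (B) has no variables for flexible
  consumption and demand reduction. The decision vector of resource \<open>r\<close> at time \<open>t\<close> is \<open>col r t\<close>.
\<close>

type_synonym plan_A =
  "unit_series \<times> unit_series \<times> unit_series \<times> unit_series \<times> unit_series \<times> col_series \<times> series \<times> series"
type_synonym plan_B =
  "unit_series \<times> unit_series \<times> unit_series \<times> col_series \<times> series \<times> series"

definition col_space :: "scenario \<Rightarrow> col_series set" where
  "col_space S = family (n_col S) (\<lambda>r. family (horizon S) (\<lambda>t. real_space (col_dim S r)))"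

definition plans_A :: "scenario \<Rightarrow> plan_A set" where
  "plans_A S =
     family (n_sto S) (\<lambda>i. real_space (horizon S)) \<times>
     family (n_sto S) (\<lambda>i. real_space (horizon S)) \<times>
     family (n_sto S) (\<lambda>i. real_space (horizon S + 1)) \<times>
     family (n_flex S) (\<lambda>j. real_space (horizon S)) \<times>
     family (n_flex S) (\<lambda>j. real_space (horizon S)) \<times>
     col_space S \<times> real_space (horizon S) \<times> real_space (horizon S)"

definition plans_B :: "scenario \<Rightarrow> plan_B set" where
  "plans_B S =
     family (n_sto S) (\<lambda>i. real_space (horizon S)) \<times>
     family (n_sto S) (\<lambda>i. real_space (horizon S)) \<times>
     family (n_sto S) (\<lambda>i. real_space (horizon S + 1)) \<times>
     col_space S \<times> real_space (horizon S) \<times> real_space (horizon S)"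

definition total_supply :: "scenario \<Rightarrow> unit_series \<Rightarrow> col_series \<Rightarrow> series \<Rightarrow> nat \<Rightarrow> real" where
  "total_supply S dis col ue t = conv_gen S t + renew_gen S t + (\<Sum>i=1..n_sto S. dis i t) + ue t
     + col_output S (\<lambda>r. col r t)"

text \<open>\<open>fl\<close> is the aggregate consumption of the flexible-demand resources.\<close>

definition total_demand ::
  "scenario \<Rightarrow> unit_series \<Rightarrow> series \<Rightarrow> col_series \<Rightarrow> series \<Rightarrow> nat \<Rightarrow> real" where
  "total_demand S ch fl col cur t = sys_load S t + (\<Sum>i=1..n_sto S. ch i t) + fl t + cur t
     + col_use S (\<lambda>r. col r t)"

definition storage_ok :: "scenario \<Rightarrow> unit_series \<Rightarrow> unit_series \<Rightarrow> unit_series \<Rightarrow> bool" where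
  "storage_ok S ch dis e \<longleftrightarrow>
     (\<forall>i\<in>{1..n_sto S}. e i 1 = init_soc S i \<and>
        (\<forall>t\<in>{1..horizon S}.
           0 \<le> ch i t \<and> ch i t \<le> ch_max S i \<and>
           0 \<le> dis i t \<and> dis i t \<le> dis_max S i \<and>
           energy_min S i \<le> e i (t + 1) \<and> e i (t + 1) \<le> energy_max S i \<and>
           e i (t + 1) = e i t + efficiency S i * ch i t - dis i t))"

definition col_ok :: "scenario \<Rightarrow> col_series \<Rightarrow> bool" where
  "col_ok S col \<longleftrightarrow>
     (\<forall>r\<in>{1..n_col S}. \<forall>t\<in>{1..horizon S}. \<forall>k\<in>{1..n_constr S r}. col_constr S r (col r t) k \<le> 0)"

definition flex_ok :: "scenario \<Rightarrow> unit_series \<Rightarrow> unit_series \<Rightarrow> bool" where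
  "flex_ok S flex red \<longleftrightarrow>
     (\<forall>t\<in>{1..horizon S}.
        (\<forall>j\<in>{1..n_flex S}.
           flex j t = flex_base S j t - red j t \<and> 0 \<le> red j t \<and>
           red j t \<le> red_max S j t * of_bool (conv_gen S t + renew_gen S t
             < sys_load S t + (\<Sum>j'=1..n_flex S. flex_base S j' t) + (\<Sum>r=1..n_col S. col_base S r t))) \<and>
        (\<Sum>j=1..n_flex S. red j t)
          \<le> max (sys_load S t + (\<Sum>j'=1..n_flex S. flex_base S j' t)
                   + (\<Sum>r=1..n_col S. col_base S r t) - (conv_gen S t + renew_gen S t)) 0)"

definition feasible_A :: "scenario \<Rightarrow> plan_A set" where
  "feasible_A S = {(ch, dis, e, flex, red, col, cur, ue) \<in> plans_A S.
     (\<forall>t\<in>{1..horizon S}.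
        total_supply S dis col ue t = total_demand S ch (\<lambda>t. \<Sum>j=1..n_flex S. flex j t) col cur t \<and>
        0 \<le> ue t \<and> 0 \<le> cur t \<and> (\<forall>i\<in>{1..n_sto S}. ch i t * dis i t = 0)) \<and>
     storage_ok S ch dis e \<and> flex_ok S flex red \<and> col_ok S col}"

definition feasible_B :: "scenario \<Rightarrow> plan_B set" where
  "feasible_B S = {(ch, dis, e, col, cur, ue) \<in> plans_B S.
     (\<forall>t\<in>{1..horizon S}.
        total_supply S dis col ue t = total_demand S ch (flex_total S) col cur t \<and>
        0 \<le> ue t \<and> 0 \<le> cur t) \<and>
     storage_ok S ch dis e \<and> col_ok S col}"

definition unserved_energy_A :: "scenario \<Rightarrow> plan_A \<Rightarrow> real" where
  "unserved_energy_A S = (\<lambda>(ch, dis, e, flex, red, col, cur, ue). \<Sum>t=1..horizon S. ue t)"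

definition unserved_energy_B :: "scenario \<Rightarrow> plan_B \<Rightarrow> real" where
  "unserved_energy_B S = (\<lambda>(ch, dis, e, col, cur, ue). \<Sum>t=1..horizon S. ue t)"


section \<open>Relation between the solutions\<close>

text \<open>The variables whose values the reformulation does not alter in either direction.\<close>

fun common_A :: "plan_A \<Rightarrow> unit_series \<times> col_series \<times> series" where
  "common_A (ch, dis, e, flex, red, col, cur, ue) = (e, col, ue)"

fun common_B :: "plan_B \<Rightarrow> unit_series \<times> col_series \<times> series" where
  "common_B (ch, dis, e, col, cur, ue) = (e, col, ue)"

text \<open>Passing from (A) to (B) only changes the curtailed power.\<close>

fun same_dispatch :: "plan_A \<Rightarrow> plan_B \<Rightarrow> bool" where
  "same_dispatch (ch, dis, e, flex, red, col, cur, ue) (ch', dis', e', col', cur', ue') \<longleftrightarrow>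
     (ch', dis', e', col', ue') = (ch, dis, e, col, ue)"

text \<open>
  Passing from (B) to (A) keeps the common variables and realizes \<open>flex_total S\<close> as the aggregate
  flexible consumption; charging, discharging and curtailed power may have to change in order to
  achieve complementarity.
\<close>

fun recovers :: "scenario \<Rightarrow> plan_B \<Rightarrow> plan_A \<Rightarrow> bool" where
  "recovers S q (ch, dis, e, flex, red, col, cur, ue) \<longleftrightarrow>
     common_B q = (e, col, ue) \<and>
     (\<forall>t\<in>{1..horizon S}. (\<Sum>j=1..n_flex S. flex j t) = flex_total S t)"

end

theory Submission
  imports Defs
begin

text \<open>
  From (A) to (B): a feasible demand reduction sums to at most the total reduction that (B)
  prescribes, so the flexible consumption of (A) is at least \<open>flex_total\<close> and the excess can be
  curtailed. From (B) to (A): the prescribed reduction is split proportionally to the individual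
  limits, and each storage unit keeps its state of charge but performs only the net charge
  \<open>\<eta> P\<^sup>C\<^sup>H - P\<^sup>D\<^sup>I\<^sup>S\<close> or its negative. As \<open>\<eta> \<le> 1\<close>, the netting lowers the charging power by at least as much
  as the discharging power, and the resulting surplus is curtailed. Neither passage alters the state
  of charge, the colocated resources or the unserved power.
\<close>

section \<open>Linear structure of the decision spaces\<close>

lemma linear_fun_apply: "linear f \<Longrightarrow> linear (\<lambda>x. f x i)"
  by (simp add: linear_iff scaleR_fun_def)

lemma linear_fun_pointwise: "(\<And>i. linear (\<lambda>x. f x i)) \<Longrightarrow> linear f"
  by (simp add: linear_iff scaleR_fun_def fun_eq_iff)

lemma subspace_family:
  assumes "\<And>i. subspace (X i)"
  shows "subspace (family n X)"
  using assms unfolding subspace_def family_def by (auto simp: scaleR_fun_def)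

lemma subspace_real_space: "subspace (real_space n)"
  unfolding real_space_def by (intro subspace_family subspace_UNIV)

lemma subspace_plans_A: "subspace (plans_A S)"
  unfolding plans_A_def col_space_def
  by (intro subspace_Times subspace_family subspace_real_space)

lemma subspace_plans_B: "subspace (plans_B S)"
  unfolding plans_B_def col_space_def
  by (intro subspace_Times subspace_family subspace_real_space)

lemma real_space_iff: "x \<in> real_space n \<longleftrightarrow> (\<forall>t. t \<notin> {1..n} \<longrightarrow> x t = 0)"
  by (simp add: real_space_def family_def)

lemma family_real_space_iff:
  "x \<in> family n (\<lambda>i. real_space m) \<longleftrightarrow> (\<forall>i t. i \<notin> {1..n} \<or> t \<notin> {1..m} \<longrightarrow> x i t = 0)"
proof
  assume "x \<in> family n (\<lambda>i. real_space m)"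
  then show "\<forall>i t. i \<notin> {1..n} \<or> t \<notin> {1..m} \<longrightarrow> x i t = 0"
    unfolding family_def real_space_iff by (metis (mono_tags, lifting) mem_Collect_eq zero_fun_apply)
next
  assume "\<forall>i t. i \<notin> {1..n} \<or> t \<notin> {1..m} \<longrightarrow> x i t = 0"
  then show "x \<in> family n (\<lambda>i. real_space m)"
    unfolding family_def real_space_iff by (auto simp: fun_eq_iff)
qed

text \<open>\<open>col_output\<close> and \<open>col_use\<close> are known to be affine only on the
  families of decision vectors at one time, so the time slice of a plan has to be located
  there.\<close>

lemma col_space_slice:
  assumes "col \<in> col_space S" "t \<in> {1..horizon S}"
  shows "(\<lambda>r. col r t) \<in> family (n_col S) (\<lambda>r. real_space (col_dim S r))"
  using assms unfolding col_space_def family_def by auto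


section \<open>Affine functions and convex constraints\<close>

lemma affine_on_linear: "linear h \<Longrightarrow> affine_on V h"
  unfolding affine_on_def by (rule exI[of _ h], rule exI[of _ 0]) simp

lemma affine_on_const: "affine_on V (\<lambda>x. c)"
  unfolding affine_on_def by (rule exI[of _ "\<lambda>x. 0"], rule exI[of _ c]) (simp add: linear_zero)

lemma affine_on_add:
  assumes "affine_on V f" "affine_on V g"
  shows "affine_on V (\<lambda>x. f x + g x)"
proof -
  obtain h c h' c' where "linear h" "linear h'"
      "\<forall>x\<in>V. f x = h x + c" "\<forall>x\<in>V. g x = h' x + c'"
    using assms unfolding affine_on_def by blast
  then show ?thesis
    unfolding affine_on_def
    by (intro exI[of _ "\<lambda>x. h x + h' x"] exI[of _ "c + c'"]) (simp add: linear_compose_add)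
qed

lemma affine_on_cmult:
  assumes "affine_on V f"
  shows "affine_on V (\<lambda>x. a * f x)"
proof -
  obtain h c where "linear h" "\<forall>x\<in>V. f x = h x + c"
    using assms unfolding affine_on_def by blast
  then show ?thesis
    unfolding affine_on_def
    using linear_compose_scale_right[of h a]
    by (intro exI[of _ "\<lambda>x. a * h x"] exI[of _ "a * c"]) (simp add: distrib_left)
qed

lemma affine_on_diff:
  assumes "affine_on V f" "affine_on V g"
  shows "affine_on V (\<lambda>x. f x - g x)"
  using affine_on_add[OF assms(1) affine_on_cmult[OF assms(2), of "- 1"]] by simp

lemma affine_on_sum: "(\<And>i. i \<in> I \<Longrightarrow> affine_on V (f i)) \<Longrightarrow> affine_on V (\<lambda>x. \<Sum>i\<in>I. f i x)"
  by (induction I rule: infinite_finite_induct) (auto intro: affine_on_const affine_on_add)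

lemma affine_on_compose_linear:
  assumes "affine_on W f" "linear h" "h ` V \<subseteq> W"
  shows "affine_on V (\<lambda>x. f (h x))"
proof -
  obtain k c where k: "linear k" "\<forall>x\<in>W. f x = k x + c"
    using assms(1) unfolding affine_on_def by blast
  have "linear (\<lambda>x. k (h x))"
    using linear_compose[OF assms(2) k(1)] by (simp add: o_def)
  with k assms(3) show ?thesis
    unfolding affine_on_def by blast
qed

text \<open>The convexity inequality holds with equality: the weights sum to 1, so the constant
  splits as \<open>(u + v) * c\<close>.\<close>

lemma convex_on_affine:
  assumes "convex V" "affine_on V f"
  shows "convex_on V f"
proof -
  obtain h c where h: "linear h" and f: "\<forall>x\<in>V. f x = h x + c"
    using assms(2) unfolding affine_on_def by blast
  have "f (u *\<^sub>R x + v *\<^sub>R y) = u * f x + v * f y"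
    if "x \<in> V" "y \<in> V" "0 \<le> u" "0 \<le> v" "u + v = 1" for x y u v
  proof -
    have "u *\<^sub>R x + v *\<^sub>R y \<in> V"
      using assms(1) that by (auto simp: convex_def)
    then have "f (u *\<^sub>R x + v *\<^sub>R y) = u * h x + v * h y + (u + v) * c"
      using f that(5) by (simp add: linear_add[OF h] linear_scale[OF h])
    moreover have "u * f x + v * f y = u * h x + v * h y + (u + v) * c"
      using f that(1,2) by (simp add: algebra_simps)
    ultimately show ?thesis
      by simp
  qed
  then show ?thesis
    using assms(1) unfolding convex_on_def by fastforce
qed

lemma convex_on_compose_linear:
  assumes "convex V" "convex_on W f" "linear h" "h ` V \<subseteq> W"
  shows "convex_on V (\<lambda>x. f (h x))"
  using assms unfolding convex_on_def
  by (simp add: linear_add linear_scale image_subset_iff)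

section \<open>Constraint predicates of convex programs\<close>

text \<open>The feasible-set clause of \<open>convex_program\<close> stated for a predicate, so that
  a constraint system can be assembled along its logical structure.\<close>

definition convex_constraint :: "'a::real_vector set \<Rightarrow> ('a \<Rightarrow> bool) \<Rightarrow> bool" where
  "convex_constraint V P \<longleftrightarrow>
     (\<exists>C E. finite C \<and> finite E \<and> (\<forall>c\<in>C. convex_on V c) \<and> (\<forall>h\<in>E. affine_on V h) \<and>
        (\<forall>x\<in>V. P x \<longleftrightarrow> (\<forall>c\<in>C. c x \<le> 0) \<and> (\<forall>h\<in>E. h x = 0)))"

lemma convex_programI:
  assumes "convex_on V f" "convex_constraint V P"
  shows "convex_program V {x\<in>V. P x} f"
proof -
  obtain C E where "finite C" "finite E" "\<forall>c\<in>C. convex_on V c" "\<forall>h\<in>E. affine_on V h"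
    and "\<forall>x\<in>V. P x \<longleftrightarrow> (\<forall>c\<in>C. c x \<le> 0) \<and> (\<forall>h\<in>E. h x = 0)"
    using assms(2) unfolding convex_constraint_def by blast
  with assms(1) show ?thesis
    unfolding convex_program_def by (intro conjI exI[of _ C] exI[of _ E]) auto
qed

lemma convex_constraint_le_0: "convex_on V f \<Longrightarrow> convex_constraint V (\<lambda>x. f x \<le> 0)"
  unfolding convex_constraint_def by (rule exI[of _ "{f}"], rule exI[of _ "{}"]) simp

lemma convex_constraint_le:
  assumes "convex V" "affine_on V f" "affine_on V g"
  shows "convex_constraint V (\<lambda>x. f x \<le> g x)"
  using convex_constraint_le_0[OF convex_on_affine[OF assms(1) affine_on_diff[OF assms(2,3)]]]
  by simp

lemma convex_constraint_eq:
  assumes "affine_on V f" "affine_on V g"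
  shows "convex_constraint V (\<lambda>x. f x = g x)"
  unfolding convex_constraint_def
  by (rule exI[of _ "{}"], rule exI[of _ "{\<lambda>x. f x - g x}"])
    (simp add: affine_on_diff[OF assms])

lemma convex_constraint_conj:
  assumes "convex_constraint V P" "convex_constraint V Q"
  shows "convex_constraint V (\<lambda>x. P x \<and> Q x)"
proof -
  obtain C E where P: "finite C" "finite E" "\<forall>c\<in>C. convex_on V c" "\<forall>h\<in>E. affine_on V h"
      "\<forall>x\<in>V. P x \<longleftrightarrow> (\<forall>c\<in>C. c x \<le> 0) \<and> (\<forall>h\<in>E. h x = 0)"
    using assms(1) unfolding convex_constraint_def by blast
  obtain C' E' where Q: "finite C'" "finite E'" "\<forall>c\<in>C'. convex_on V c" "\<forall>h\<in>E'. affine_on V h"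
      "\<forall>x\<in>V. Q x \<longleftrightarrow> (\<forall>c\<in>C'. c x \<le> 0) \<and> (\<forall>h\<in>E'. h x = 0)"
    using assms(2) unfolding convex_constraint_def by blast
  have "\<forall>x\<in>V. P x \<and> Q x \<longleftrightarrow> (\<forall>c\<in>C \<union> C'. c x \<le> 0) \<and> (\<forall>h\<in>E \<union> E'. h x = 0)"
    using P(5) Q(5) by (simp add: ball_Un conj_ac)
  then show ?thesis
    unfolding convex_constraint_def using P(1-4) Q(1-4)
    by (intro exI[of _ "C \<union> C'"] exI[of _ "E \<union> E'"]) (simp add: ball_Un)
qed

lemma convex_constraint_Ball:
  assumes "finite I" "\<And>i. i \<in> I \<Longrightarrow> convex_constraint V (P i)"
  shows "convex_constraint V (\<lambda>x. \<forall>i\<in>I. P i x)"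
  using assms
proof (induction I)
  case empty
  then show ?case
    unfolding convex_constraint_def by (intro exI[of _ "{}"]) simp
next
  case (insert i I)
  then show ?case
    by (simp add: convex_constraint_conj)
qed

text \<open>Without the complementarity products, and with the constant \<open>flex_total\<close> as
  flexible consumption, every constraint is affine in the plan except the components of
  \<open>col_constr\<close>, which are convex functions of one linear coordinate block.\<close>

lemma convex_program_feasible_B:
  assumes "valid_scenario S" "convex_on (plans_B S) f"
  shows "convex_program (plans_B S) (feasible_B S) f"
proof -
  let ?V = "plans_B S"
  \<comment> \<open>Projections replace the tuple pattern of \<open>feasible_B\<close>, so that each
    variable becomes a linear map on plans.\<close>
  let ?ch = "\<lambda>q::plan_B. fst q"
  let ?dis = "\<lambda>q::plan_B. fst (snd q)"
  let ?e = "\<lambda>q::plan_B. fst (snd (snd q))"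
  let ?col = "\<lambda>q::plan_B. fst (snd (snd (snd q)))"
  let ?cur = "\<lambda>q::plan_B. fst (snd (snd (snd (snd q))))"
  let ?ue = "\<lambda>q::plan_B. snd (snd (snd (snd (snd q))))"
  have conv: "convex ?V"
    by (rule subspace_imp_convex[OF subspace_plans_B])
  have lin: "linear ?ch" "linear ?dis" "linear ?e" "linear ?col" "linear ?cur" "linear ?ue"
    by (simp_all add: linear_iff)
  have aff: "affine_on ?V (\<lambda>q. ?ch q i t)" "affine_on ?V (\<lambda>q. ?dis q i t)"
      "affine_on ?V (\<lambda>q. ?e q i t)" "affine_on ?V (\<lambda>q. ?cur q t)" "affine_on ?V (\<lambda>q. ?ue q t)"
    for i t
    by (rule lin(1-3)[THEN linear_fun_apply, THEN linear_fun_apply, THEN affine_on_linear]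
        lin(5,6)[THEN linear_fun_apply, THEN affine_on_linear])+
  have slice: "linear (\<lambda>q. (\<lambda>r. ?col q r t))" for t
    by (rule linear_fun_pointwise) (rule linear_fun_apply[OF linear_fun_apply[OF lin(4)]])
  have slice_in: "(\<lambda>q. (\<lambda>r. ?col q r t)) ` ?V \<subseteq> family (n_col S) (\<lambda>r. real_space (col_dim S r))"
    if "t \<in> {1..horizon S}" for t
    using col_space_slice[OF _ that] by (auto simp: plans_B_def)
  have out_aff: "affine_on ?V (\<lambda>q. col_output S (\<lambda>r. ?col q r t))"
    and use_aff: "affine_on ?V (\<lambda>q. col_use S (\<lambda>r. ?col q r t))" if "t \<in> {1..horizon S}" for t
    using assms(1) affine_on_compose_linear[OF _ slice slice_in[OF that]]
    unfolding valid_scenario_def by blast+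
  have constr: "convex_on ?V (\<lambda>q. col_constr S r (?col q r t) k)"
    if "t \<in> {1..horizon S}" "r \<in> {1..n_col S}" "k \<in> {1..n_constr S r}" for t r k
  proof (rule convex_on_compose_linear[OF conv, where f = "\<lambda>p. col_constr S r p k"])
    show "convex_on (real_space (col_dim S r)) (\<lambda>p. col_constr S r p k)"
      using assms(1) that unfolding valid_scenario_def by blast
    show "linear (\<lambda>q. ?col q r t)"
      by (rule linear_fun_apply[OF linear_fun_apply[OF lin(4)]])
    show "(\<lambda>q. ?col q r t) ` ?V \<subseteq> real_space (col_dim S r)"
      using slice_in[OF that(1)] that(2) by (auto simp: family_def)
  qed
  have "convex_constraint ?V (\<lambda>q.
      (\<forall>t\<in>{1..horizon S}.
        total_supply S (?dis q) (?col q) (?ue q) t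
          = total_demand S (?ch q) (flex_total S) (?col q) (?cur q) t \<and>
        0 \<le> ?ue q t \<and> 0 \<le> ?cur q t) \<and>
      storage_ok S (?ch q) (?dis q) (?e q) \<and> col_ok S (?col q))"
    \<comment> \<open>The unfolded predicate consists of conjunctions, finite quantifiers, equations
      and inequalities. The closure rules reduce it to the coordinate facts \<open>aff\<close>,
      \<open>out_aff\<close>, \<open>use_aff\<close> and \<open>constr\<close>.\<close>
    unfolding total_supply_def total_demand_def storage_ok_def col_ok_def
    by (intro convex_constraint_conj convex_constraint_Ball convex_constraint_eq
        convex_constraint_le_0[OF constr] convex_constraint_le[OF conv] finite_atLeastAtMost
        affine_on_add affine_on_diff affine_on_sum affine_on_cmult affine_on_const
        aff out_aff use_aff)
  from convex_programI[OF assms(2) this] show ?thesis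
    by (simp add: feasible_B_def case_prod_unfold)
qed


section \<open>Passing between the two problems\<close>

text \<open>The two transfer conditions force \<open>f\<close> X = h \<open>Y\<close>, and both the
  optimal value and the optimality of a feasible point depend only on the set of attained
  values.\<close>

lemma equivalent_reformulationI:
  assumes "\<And>x. x \<in> X \<Longrightarrow> \<exists>y\<in>Y. fwd x y \<and> h y = f x"
    and "\<And>y. y \<in> Y \<Longrightarrow> \<exists>x\<in>X. bwd y x \<and> f x = h y"
  shows "equivalent_reformulation X f Y h fwd bwd"
proof -
  have fwd: "\<forall>x\<in>X. \<exists>y\<in>Y. fwd x y \<and> h y = f x"
    and bwd: "\<forall>y\<in>Y. \<exists>x\<in>X. bwd y x \<and> f x = h y"
    using assms by blast+
  have "f ` X \<subseteq> h ` Y"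
    by (intro image_subsetI) (metis fwd imageI)
  moreover have "h ` Y \<subseteq> f ` X"
    by (intro image_subsetI) (metis bwd imageI)
  ultimately have image: "f ` X = h ` Y"
    by (rule subset_antisym)
  have "optimal_value X f = Inf (ereal ` f ` X)" "optimal_value Y h = Inf (ereal ` h ` Y)"
    by (simp_all add: optimal_value_def image_image)
  then have "optimal_value X f = optimal_value Y h"
    unfolding image by simp
  moreover have opt: "optimal X f x \<longleftrightarrow> x \<in> X \<and> (\<forall>v\<in>f ` X. f x \<le> v)"
    "optimal Y h y \<longleftrightarrow> y \<in> Y \<and> (\<forall>v\<in>h ` Y. h y \<le> v)" for x y
    by (auto simp: optimal_def is_arg_min_linorder)
  have "\<exists>y. optimal Y h y \<and> fwd x y" if "optimal X f x" for x
    using that fwd unfolding opt image by metis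
  moreover have "\<exists>x. optimal X f x \<and> bwd y x" if "optimal Y h y" for y
    using that bwd unfolding opt image by metis
  ultimately show ?thesis
    unfolding equivalent_reformulation_def using fwd bwd by blast
qed

section \<open>Attainable aggregate flexible consumption\<close>

text \<open>The individual limits and the aggregate limit together bound the total reduction by the
  amount that \<open>flex_total\<close> subtracts.\<close>

lemma flex_total_le:
  assumes "flex_ok S flex red" "t \<in> {1..horizon S}"
  shows "flex_total S t \<le> (\<Sum>j=1..n_flex S. flex j t)"
proof -
  have t: "\<And>j. j \<in> {1..n_flex S} \<Longrightarrow> flex j t = flex_base S j t - red j t"
      "\<And>j. j \<in> {1..n_flex S} \<Longrightarrow> red j t \<le> red_max S j t * of_bool (0 < shortfall S t)"
      "(\<Sum>j=1..n_flex S. red j t) \<le> max (shortfall S t) 0"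
    using assms unfolding flex_ok_def shortfall_def by (auto simp: algebra_simps)
  have "(\<Sum>j=1..n_flex S. red j t)
      \<le> (if shortfall S t \<le> 0 then 0 else min (\<Sum>j=1..n_flex S. red_max S j t) (shortfall S t))"
    \<comment> \<open>Without a shortfall the aggregate limit is already 0. Otherwise
      \<open>of_bool\<close> is at most 1 and in fact equal to 1, and the two limits give the
      minimum.\<close>
    using t(3) sum_mono[of "{1..n_flex S}" "\<lambda>j. red j t" "\<lambda>j. red_max S j t"] t(2) by auto
  moreover have "(\<Sum>j=1..n_flex S. flex j t)
      = (\<Sum>j=1..n_flex S. flex_base S j t) - (\<Sum>j=1..n_flex S. red j t)"
    by (simp add: t(1) sum_subtractf)
  ultimately show ?thesis
    by (auto simp: flex_total_def split: if_splits)
qed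

text \<open>All limits are scaled by the common factor \<open>s / sum b J\<close>, which is at most
  1.\<close>

lemma proportional_split:
  fixes b :: "'a \<Rightarrow> real"
  assumes "\<And>j. j \<in> J \<Longrightarrow> 0 \<le> b j" "0 \<le> s" "s \<le> sum b J"
  obtains x where "\<And>j. j \<in> J \<Longrightarrow> 0 \<le> x j \<and> x j \<le> b j" "sum x J = s"
proof (rule that[of "\<lambda>j. b j * (s / sum b J)"])
  show "0 \<le> b j * (s / sum b J) \<and> b j * (s / sum b J) \<le> b j" if "j \<in> J" for j
  proof
    show "0 \<le> b j * (s / sum b J)"
      using assms that by simp
    have "s / sum b J \<le> 1"
      using assms(2,3) by (auto simp: divide_le_eq_1)
    then show "b j * (s / sum b J) \<le> b j"
      by (rule mult_left_le) (rule assms(1)[OF that])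
  qed
  \<comment> \<open>If all limits sum to 0, then \<open>s = 0\<close>, and division by zero yields
    the correct value 0.\<close>
  show "(\<Sum>j\<in>J. b j * (s / sum b J)) = s"
    using assms(2,3) by (cases "sum b J = 0") (simp_all flip: sum_distrib_right sum_divide_distrib)
qed

text \<open>Sharpness of \<open>flex_total_le\<close>, in all periods at once: the flexible-demand
  constraints do not couple different periods, so each reduction can be split separately.\<close>

lemma flex_total_attained:
  assumes "valid_scenario S"
  obtains flex red where
    "flex \<in> family (n_flex S) (\<lambda>j. real_space (horizon S))"
    "red \<in> family (n_flex S) (\<lambda>j. real_space (horizon S))"
    "flex_ok S flex red"
    "\<And>t. t \<in> {1..horizon S} \<Longrightarrow> (\<Sum>j=1..n_flex S. flex j t) = flex_total S t"
proof -
  \<comment> \<open>The total reduction in period \<open>t\<close>, chosen so that baseline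
    consumption minus \<open>target t\<close> is \<open>flex_total S t\<close>.\<close>
  define target where "target t = (if shortfall S t \<le> 0 then 0
    else min (\<Sum>j=1..n_flex S. red_max S j t) (shortfall S t))" for t
  have "\<exists>x. (\<forall>j\<in>{1..n_flex S}. 0 \<le> x j \<and> x j \<le> red_max S j t * of_bool (0 < shortfall S t)) \<and>
      (\<Sum>j=1..n_flex S. x j) = target t"
    if "t \<in> {1..horizon S}" for t
  proof -
    have nonneg: "0 \<le> red_max S j t" if "j \<in> {1..n_flex S}" for j
      using assms that \<open>t \<in> {1..horizon S}\<close> unfolding valid_scenario_def by blast
    have "0 \<le> target t"
      "target t \<le> (\<Sum>j=1..n_flex S. red_max S j t * of_bool (0 < shortfall S t))"
      using nonneg by (auto simp: target_def intro!: sum_nonneg)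
    with nonneg show ?thesis
      \<comment> \<open>The indicator is absorbed into the limits to be split; without a shortfall
        all limits and the target are 0.\<close>
      using proportional_split[of "{1..n_flex S}" "\<lambda>j. red_max S j t * of_bool (0 < shortfall S t)"
          "target t"]
      by (metis (no_types, lifting) of_bool_def mult_nonneg_nonneg zero_le_one order_refl)
  qed
  then obtain x where x: "\<And>t j. t \<in> {1..horizon S} \<Longrightarrow> j \<in> {1..n_flex S} \<Longrightarrow>
        0 \<le> x t j \<and> x t j \<le> red_max S j t * of_bool (0 < shortfall S t)"
      "\<And>t. t \<in> {1..horizon S} \<Longrightarrow> (\<Sum>j=1..n_flex S. x t j) = target t"
    by metis
  \<comment> \<open>The choice \<open>x\<close> is unconstrained outside the index ranges, where
    membership in \<open>family\<close> demands the value 0.\<close>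
  define inside where "inside j t \<longleftrightarrow> j \<in> {1..n_flex S} \<and> t \<in> {1..horizon S}" for j t
  define red where "red j t = (if inside j t then x t j else 0)" for j t
  define flex where "flex j t = (if inside j t then flex_base S j t - x t j else 0)" for j t
  have sum_red: "(\<Sum>j=1..n_flex S. red j t) = target t"
    and sum_flex: "(\<Sum>j=1..n_flex S. flex j t) = (\<Sum>j=1..n_flex S. flex_base S j t) - target t"
    if "t \<in> {1..horizon S}" for t
    using that x(2) by (simp_all add: red_def flex_def inside_def sum_subtractf)
  show thesis
  proof (rule that[of flex red])
    show "flex \<in> family (n_flex S) (\<lambda>j. real_space (horizon S))"
      "red \<in> family (n_flex S) (\<lambda>j. real_space (horizon S))"
      unfolding family_real_space_iff by (auto simp: flex_def red_def inside_def)
    have short: "conv_gen S t + renew_gen S t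
        < sys_load S t + (\<Sum>j'=1..n_flex S. flex_base S j' t) + (\<Sum>r=1..n_col S. col_base S r t)
        \<longleftrightarrow> 0 < shortfall S t"
      "sys_load S t + (\<Sum>j'=1..n_flex S. flex_base S j' t) + (\<Sum>r=1..n_col S. col_base S r t)
        - (conv_gen S t + renew_gen S t) = shortfall S t" for t
      by (auto simp: shortfall_def)
    show "flex_ok S flex red"
      unfolding flex_ok_def short
    proof (intro ballI conjI)
      fix t j assume "t \<in> {1..horizon S}" "j \<in> {1..n_flex S}"
      then show "flex j t = flex_base S j t - red j t" "0 \<le> red j t"
        "red j t \<le> red_max S j t * of_bool (0 < shortfall S t)"
        using x(1) by (simp_all add: flex_def red_def inside_def)
    next
      fix t assume "t \<in> {1..horizon S}"
      then show "(\<Sum>j=1..n_flex S. red j t) \<le> max (shortfall S t) 0"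
        by (simp only: sum_red) (auto simp: target_def)
    qed
    show "(\<Sum>j=1..n_flex S. flex j t) = flex_total S t" if "t \<in> {1..horizon S}" for t
      by (simp only: sum_flex[OF that]) (simp add: target_def flex_total_def)
  qed
qed

section \<open>From (A) to (B)\<close>

lemma same_dispatch_exists:
  assumes "p \<in> feasible_A S"
  shows "\<exists>q\<in>feasible_B S. same_dispatch p q"
proof -
  obtain ch dis e flex red col cur ue where p: "p = (ch, dis, e, flex, red, col, cur, ue)"
    by (cases p) auto
  \<comment> \<open>The excess flexible consumption becomes curtailment. The explicit 0 matters
    because \<open>flex_total S t\<close> need not vanish outside the horizon.\<close>
  define cur' where "cur' t = (if t \<in> {1..horizon S}
    then cur t + ((\<Sum>j=1..n_flex S. flex j t) - flex_total S t) else 0)" for t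
  have "cur' \<in> real_space (horizon S)"
    by (auto simp: real_space_iff cur'_def)
  moreover have "0 \<le> cur' t"
    and "total_demand S ch (flex_total S) col cur' t
      = total_demand S ch (\<lambda>t. \<Sum>j=1..n_flex S. flex j t) col cur t" if "t \<in> {1..horizon S}" for t
    using assms that flex_total_le[of S flex red t]
    by (simp_all add: p feasible_A_def cur'_def total_demand_def)
  ultimately have "(ch, dis, e, col, cur', ue) \<in> feasible_B S"
    using assms by (auto simp: p feasible_A_def feasible_B_def plans_A_def plans_B_def)
  then show ?thesis
    by (intro bexI[of _ "(ch, dis, e, col, cur', ue)"]) (auto simp: p)
qed

section \<open>Storage netting and the passage from (B) to (A)\<close>

text \<open>If \<open>d \<le> \<eta> * c\<close>, discharging falls by \<open>d\<close> and charging
  by \<open>d / \<eta>\<close>, which is at least \<open>d\<close>. Otherwise charging falls by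
  \<open>c\<close> and discharging by \<open>\<eta> * c\<close>, which is at most \<open>c\<close>.
  The last inequality is what makes the curtailment in \<open>recovers_exists\<close>
  nonnegative.\<close>

lemma netting:
  fixes c d \<eta> :: real
  assumes "0 < \<eta>" "\<eta> \<le> 1" "0 \<le> c" "0 \<le> d"
  defines "c' \<equiv> max (\<eta> * c - d) 0 / \<eta>" and "d' \<equiv> max (d - \<eta> * c) 0"
  shows "c' * d' = 0" "0 \<le> c'" "c' \<le> c" "0 \<le> d'" "d' \<le> d"
    "\<eta> * c' - d' = \<eta> * c - d" "d - d' \<le> c - c'"
proof -
  have d_le: "d \<le> d / \<eta>"
    using assms(1,2,4) by (simp add: pos_le_divide_eq mult_left_le)
  have \<eta>c: "0 \<le> \<eta> * c" "\<eta> * c \<le> c"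
    using assms(1-3) by (simp_all add: mult_left_le_one_le)
  consider "d \<le> \<eta> * c" "c' = c - d / \<eta>" "d' = 0" | "\<eta> * c \<le> d" "c' = 0" "d' = d - \<eta> * c"
    using assms(1) by (cases "d \<le> \<eta> * c") (auto simp: c'_def d'_def field_simps)
  then have "c' * d' = 0 \<and> 0 \<le> c' \<and> c' \<le> c \<and> 0 \<le> d' \<and> d' \<le> d \<and>
      \<eta> * c' - d' = \<eta> * c - d \<and> d - d' \<le> c - c'"
  proof cases
    case 1
    moreover have "d / \<eta> \<le> c"
      using 1(1) assms(1) by (simp add: pos_divide_le_eq mult.commute)
    moreover have "\<eta> * (c - d / \<eta>) = \<eta> * c - d"
      using assms(1) by (simp add: right_diff_distrib)
    ultimately show ?thesis
      using d_le assms(3,4) by simp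
  next
    case 2
    then show ?thesis
      using \<eta>c assms(3,4) by simp
  qed
  then show "c' * d' = 0" "0 \<le> c'" "c' \<le> c" "0 \<le> d'" "d' \<le> d"
    "\<eta> * c' - d' = \<eta> * c - d" "d - d' \<le> c - c'"
    by blast+
qed

lemma recovers_exists:
  assumes valid: "valid_scenario S" and q_feas: "q \<in> feasible_B S"
  shows "\<exists>p\<in>feasible_A S. recovers S q p"
proof -
  obtain ch dis e col cur ue where q: "q = (ch, dis, e, col, cur, ue)"
    by (cases q) auto
  obtain flex red where
    flex: "flex \<in> family (n_flex S) (\<lambda>j. real_space (horizon S))"
      "red \<in> family (n_flex S) (\<lambda>j. real_space (horizon S))" "flex_ok S flex red"
    and sum_flex: "\<And>t. t \<in> {1..horizon S} \<Longrightarrow> (\<Sum>j=1..n_flex S. flex j t) = flex_total S t"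
    using flex_total_attained[OF valid] by blast
  have plan: "(ch, dis, e, col, cur, ue) \<in> plans_B S"
    and sto: "storage_ok S ch dis e" and col: "col_ok S col"
    and balance: "\<And>t. t \<in> {1..horizon S} \<Longrightarrow>
      total_supply S dis col ue t = total_demand S ch (flex_total S) col cur t"
    and nonneg: "\<And>t. t \<in> {1..horizon S} \<Longrightarrow> 0 \<le> ue t \<and> 0 \<le> cur t"
    using q_feas by (auto simp: q feasible_B_def)
  define ch' where "ch' i t = max (efficiency S i * ch i t - dis i t) 0 / efficiency S i" for i t
  define dis' where "dis' i t = max (dis i t - efficiency S i * ch i t) 0" for i t
  \<comment> \<open>Netting lowers storage demand by the first sum and storage supply by the second;
    curtailing their difference restores the balance.\<close>
  define cur' where "cur' t = cur t
    + ((\<Sum>i=1..n_sto S. ch i t - ch' i t) - (\<Sum>i=1..n_sto S. dis i t - dis' i t))" for t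
  have net: "ch' i t * dis' i t = 0" "0 \<le> ch' i t" "ch' i t \<le> ch i t"
      "0 \<le> dis' i t" "dis' i t \<le> dis i t"
      "efficiency S i * ch' i t - dis' i t = efficiency S i * ch i t - dis i t"
      "dis i t - dis' i t \<le> ch i t - ch' i t"
    if "i \<in> {1..n_sto S}" "t \<in> {1..horizon S}" for i t
  proof -
    have "0 < efficiency S i" "efficiency S i \<le> 1"
      using valid that unfolding valid_scenario_def by blast+
    moreover have "0 \<le> ch i t" "0 \<le> dis i t"
      using sto that unfolding storage_ok_def by blast+
    ultimately show "ch' i t * dis' i t = 0" "0 \<le> ch' i t" "ch' i t \<le> ch i t"
      "0 \<le> dis' i t" "dis' i t \<le> dis i t"
      "efficiency S i * ch' i t - dis' i t = efficiency S i * ch i t - dis i t"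
      "dis i t - dis' i t \<le> ch i t - ch' i t"
      unfolding ch'_def dis'_def by (rule netting)+
  qed
  \<comment> \<open>Outside the index ranges \<open>ch\<close> and \<open>dis\<close> are 0, hence
    so are their net versions, whatever value the efficiency takes there.\<close>
  have "ch' \<in> family (n_sto S) (\<lambda>i. real_space (horizon S))"
    and "dis' \<in> family (n_sto S) (\<lambda>i. real_space (horizon S))"
    and "cur' \<in> real_space (horizon S)"
    using plan by (auto simp: plans_B_def family_real_space_iff real_space_iff
        ch'_def dis'_def cur'_def)
  then have plan': "(ch', dis', e, flex, red, col, cur', ue) \<in> plans_A S"
    using plan flex by (simp add: plans_A_def plans_B_def)
  have sto': "storage_ok S ch' dis' e"
    unfolding storage_ok_def
  proof (intro ballI conjI)
    fix i t assume it: "i \<in> {1..n_sto S}" "t \<in> {1..horizon S}"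
    have old: "ch i t \<le> ch_max S i" "dis i t \<le> dis_max S i"
        "energy_min S i \<le> e i (t + 1)" "e i (t + 1) \<le> energy_max S i"
        "e i (t + 1) = e i t + efficiency S i * ch i t - dis i t"
      using sto it unfolding storage_ok_def by blast+
    note new = net[OF it]
    show "0 \<le> ch' i t" "0 \<le> dis' i t" "energy_min S i \<le> e i (t + 1)"
        "e i (t + 1) \<le> energy_max S i"
      by (fact new old)+
    \<comment> \<open>The net charge is unchanged, so the same \<open>e\<close> satisfies the
      recursion, and the power limits survive because both powers only decrease.\<close>
    show "ch' i t \<le> ch_max S i" "dis' i t \<le> dis_max S i"
        "e i (t + 1) = e i t + efficiency S i * ch' i t - dis' i t"
      using new old by linarith+
  qed (use sto in \<open>auto simp: storage_ok_def\<close>)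
  have cur': "0 \<le> cur' t" if "t \<in> {1..horizon S}" for t
  proof -
    have "(\<Sum>i=1..n_sto S. dis i t - dis' i t) \<le> (\<Sum>i=1..n_sto S. ch i t - ch' i t)"
      by (rule sum_mono) (rule net(7)[OF _ that])
    then show ?thesis
      using nonneg[OF that] by (simp add: cur'_def)
  qed
  have balance': "total_supply S dis' col ue t
      = total_demand S ch' (\<lambda>t. \<Sum>j=1..n_flex S. flex j t) col cur' t"
    if "t \<in> {1..horizon S}" for t
    using balance[OF that] sum_flex[OF that]
    by (simp add: total_supply_def total_demand_def cur'_def sum_subtractf)
  have "(ch', dis', e, flex, red, col, cur', ue) \<in> feasible_A S"
    using plan' sto' col flex(3) balance' cur' nonneg net(1) by (simp add: feasible_A_def)
  moreover have "recovers S q (ch', dis', e, flex, red, col, cur', ue)"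
    using sum_flex by (simp add: q)
  ultimately show ?thesis
    by blast
qed

section \<open>Objectives depending on the common variables\<close>

lemma same_dispatch_common: "same_dispatch p q \<Longrightarrow> common_A p = common_B q"
  by (cases p; cases q) auto

lemma recovers_common: "recovers S q p \<Longrightarrow> common_A p = common_B q"
  by (cases p; cases q) auto

text \<open>Both passages preserve state of charge, colocated decisions and unserved power, so two
  objectives that agree whenever these coincide take equal values at transferred points.\<close>

lemma equivalent_reformulation_common:
  assumes "valid_scenario S"
    and R: "\<forall>p\<in>plans_A S. \<forall>q\<in>plans_B S. common_A p = common_B q \<longrightarrow> R p = R' q"
  shows "equivalent_reformulation (feasible_A S) R (feasible_B S) R' same_dispatch (recovers S)"
proof (rule equivalent_reformulationI)
  have sub: "feasible_A S \<subseteq> plans_A S" "feasible_B S \<subseteq> plans_B S"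
    by (auto simp: feasible_A_def feasible_B_def)
  then have eq: "R p = R' q"
    if "p \<in> feasible_A S" "q \<in> feasible_B S" "common_A p = common_B q" for p q
    using R that by (meson subsetD)
  show "\<exists>q\<in>feasible_B S. same_dispatch p q \<and> R' q = R p" if p: "p \<in> feasible_A S" for p
  proof -
    obtain q where q: "q \<in> feasible_B S" "same_dispatch p q"
      using same_dispatch_exists[OF p] by (rule bexE)
    with eq[OF p q(1) same_dispatch_common[OF q(2)]] show ?thesis
      by (intro bexI[of _ q] conjI) simp_all
  qed
  show "\<exists>p\<in>feasible_A S. recovers S q p \<and> R p = R' q" if q: "q \<in> feasible_B S" for q
  proof -
    obtain p where p: "p \<in> feasible_A S" "recovers S q p"
      using recovers_exists[OF assms(1) q] by (rule bexE)
    with eq[OF p(1) q recovers_common[OF p(2)]] show ?thesis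
      by (intro bexI[of _ p] conjI) simp_all
  qed
qed

text \<open>\<open>R'\<close> is \<open>R\<close> composed with the linear embedding that sets the
  flexible variables to 0. The embedded plan may be infeasible for (A); only its membership in
  \<open>plans_A\<close> matters.\<close>

lemma convex_on_plans_B:
  assumes "convex_on (plans_A S) R"
    and R: "\<forall>p\<in>plans_A S. \<forall>q\<in>plans_B S. common_A p = common_B q \<longrightarrow> R p = R' q"
  shows "convex_on (plans_B S) R'"
proof -
  define lift :: "plan_B \<Rightarrow> plan_A"
    where "lift = (\<lambda>(ch, dis, e, col, cur, ue). (ch, dis, e, 0, 0, col, cur, ue))"
  have zero: "0 \<in> family (n_flex S) (\<lambda>j. real_space (horizon S))"
    by (simp add: family_real_space_iff)
  have lift_in: "lift q \<in> plans_A S" if "q \<in> plans_B S" for q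
    using that zero by (auto simp: lift_def plans_A_def plans_B_def)
  have "convex_on (plans_B S) (\<lambda>q. R (lift q))"
  proof (rule convex_on_compose_linear[OF _ assms(1)])
    show "convex (plans_B S)"
      by (rule subspace_imp_convex[OF subspace_plans_B])
    show "linear lift"
      by (auto simp: linear_iff lift_def)
    show "lift ` plans_B S \<subseteq> plans_A S"
      using lift_in by blast
  qed
  moreover have "R (lift q) = R' q" if "q \<in> plans_B S" for q
    using R lift_in[OF that] that by (cases q) (auto simp: lift_def)
  \<comment> \<open>The identity with \<open>R'\<close> is available only on \<open>plans_B\<close>,
    and the convexity inequality also evaluates \<open>R'\<close> at the combination.\<close>
  moreover have "u *\<^sub>R x + v *\<^sub>R y \<in> plans_B S"
    if "x \<in> plans_B S" "y \<in> plans_B S" for u v x y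
    using that subspace_plans_B by (intro subspace_add subspace_scale)
  ultimately show ?thesis
    unfolding convex_on_def by simp
qed

lemma convex_on_unserved_energy_A: "convex_on (plans_A S) (unserved_energy_A S)"
proof (rule convex_on_affine)
  show "convex (plans_A S)"
    by (rule subspace_imp_convex[OF subspace_plans_A])
  have "linear (\<lambda>p::plan_A. snd (snd (snd (snd (snd (snd (snd p)))))))"
    by (simp add: linear_iff)
  from linear_fun_apply[OF this] show "affine_on (plans_A S) (unserved_energy_A S)"
    unfolding unserved_energy_A_def case_prod_unfold
    by (intro affine_on_sum affine_on_linear)
qed

lemma unserved_energy_common:
  "common_A p = common_B q \<Longrightarrow> unserved_energy_A S p = unserved_energy_B S q"
  by (cases p rule: common_A.cases; cases q rule: common_B.cases)
    (simp add: unserved_energy_A_def unserved_energy_B_def)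

text \<open>The objectives of (A) and (B) have different domains, and netting may alter charging,
  discharging and curtailment. A general \<open>R\<close> is therefore paired with \<open>R'\<close>
  through the variables that both passages preserve; unserved energy is one such pair.\<close>

theorem proposition1:
  fixes S :: scenario
  assumes "valid_scenario S"
  shows "(convex_on (plans_A S) (unserved_energy_A S) \<and>
          convex_program (plans_B S) (feasible_B S) (unserved_energy_B S) \<and>
          equivalent_reformulation (feasible_A S) (unserved_energy_A S)
            (feasible_B S) (unserved_energy_B S) same_dispatch (recovers S)) \<and>
         (\<forall>R R'. convex_on (plans_A S) R \<and>
            (\<forall>p\<in>plans_A S. \<forall>q\<in>plans_B S. common_A p = common_B q \<longrightarrow> R p = R' q) \<longrightarrow>
              convex_program (plans_B S) (feasible_B S) R' \<and>
              equivalent_reformulation (feasible_A S) R (feasible_B S) R' same_dispatch (recovers S))"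
proof -
  have main: "convex_program (plans_B S) (feasible_B S) R' \<and>
      equivalent_reformulation (feasible_A S) R (feasible_B S) R' same_dispatch (recovers S)"
    if "convex_on (plans_A S) R"
      "\<forall>p\<in>plans_A S. \<forall>q\<in>plans_B S. common_A p = common_B q \<longrightarrow> R p = R' q" for R R'
    using convex_program_feasible_B[OF assms convex_on_plans_B[OF that]]
      equivalent_reformulation_common[OF assms that(2)] by blast
  show ?thesis
  proof (intro conjI[OF conjI] allI impI)
    show "convex_on (plans_A S) (unserved_energy_A S)"
      by (rule convex_on_unserved_energy_A)
    then show "convex_program (plans_B S) (feasible_B S) (unserved_energy_B S) \<and>
        equivalent_reformulation (feasible_A S) (unserved_energy_A S)
          (feasible_B S) (unserved_energy_B S) same_dispatch (recovers S)"
      by (rule main) (blast intro: unserved_energy_common)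
  qed (rule main, erule conjunct1, erule conjunct2)
qed

end
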